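(* Let $T_N,n_T>0$ and $p_{change}\in(0,1)$, and let the change instants $T_{C_0}<T_{C_1}<T_{C_2}<\cdots$ of the bandit follow a Poisson arrival process with parameter $\lambda_C>0$. To limit to $p_{change}$ the probability that changes occur too frequently, i.e. to have $\mathbb P\left(T_{C_{l+1}}-T_{C_l}\le n_T+T_N\right)\le p_{change}$, the bound on the value of $\lambda_C$ is $$\lambda_C\le\frac{1}{n_T+T_N}\ln\left(\frac{1}{1-p_{change}}\right).$$
   Context: The means of the bandit's arms are piecewise constant in time and change simultaneously at the instants $T_{C_l}$, whose gaps are exponentially distributed: $\mathbb P(T_{C_{l+1}}-T_{C_l}\le k)=1-e^{-\lambda_C k}$. Here $T_N$ is the number of stationary time steps the algorithm needs to estimate the optimal arm's mean, and $n_T$ is the number of time steps needed after a change to detect it. *)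

theory Defs
  imports "HOL-Probability.Probability"
begin

(* Arrival instants T 0 < T 1 < ... of a Poisson process of rate r: the gaps are independent and
   exponentially distributed. The origin T 0 is only required to be independent of the gaps, so
   both usual conventions are instances: T 0 constant (typically 0), and T 0 itself the first
   arrival, hence exponentially distributed. *)
locale poisson_arrivals = prob_space M for M :: "'a measure" +
  fixes r :: real and T :: "nat \<Rightarrow> 'a \<Rightarrow> real"
  assumes increasing: "AE \<omega> in M. \<forall>l. T l \<omega> < T (Suc l) \<omega>"
    and exponential_gaps:
      "\<And>l. distributed M lborel (\<lambda>\<omega>. T (Suc l) \<omega> - T l \<omega>) (exponential_density r)"
    and independent_increments:
      "indep_vars (\<lambda>_. borel)
         (\<lambda>n. case n of 0 \<Rightarrow> T 0 | Suc l \<Rightarrow> (\<lambda>\<omega>. T (Suc l) \<omega> - T l \<omega>)) UNIV"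

end

theory Submission imports Defs begin

text \<open>A gap is exponential with rate \<open>lambda_C\<close>, so by
  \<open>exponential_distributedD_le\<close> it is at most \<open>t = n_T + T_N\<close> with
  probability \<open>1 - exp (- t * lambda_C)\<close>. Solving the bound by \<open>p_change\<close>
  for the rate uses only reversible steps, hence an equivalence.\<close>

theorem lemma3:
  fixes M :: "'a measure" and T_C :: "nat \<Rightarrow> 'a \<Rightarrow> real"
    and T_N n_T p_change lambda_C :: real and l :: nat
  assumes "T_N > 0" and "n_T > 0"
    and "p_change \<in> {0<..<1}"
    and "lambda_C > 0"
    and "poisson_arrivals M lambda_C T_C"
  shows "measure M {\<omega> \<in> space M. T_C (Suc l) \<omega> - T_C l \<omega> \<le> n_T + T_N} \<le> p_change
     \<longleftrightarrow> lambda_C \<le> 1 / (n_T + T_N) * ln (1 / (1 - p_change))"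
proof -
  interpret poisson_arrivals M lambda_C T_C by fact
  define t where "t = n_T + T_N"
  have "t > 0" using assms by (simp add: t_def)
  have "prob {\<omega> \<in> space M. T_C (Suc l) \<omega> - T_C l \<omega> \<le> t} = 1 - exp (- t * lambda_C)"
    using exponential_distributedD_le[OF exponential_gaps] \<open>t > 0\<close> \<open>lambda_C > 0\<close> by simp
  also have "\<dots> \<le> p_change \<longleftrightarrow> 1 - p_change \<le> exp (- t * lambda_C)"
    by linarith
  also have "\<dots> \<longleftrightarrow> ln (1 - p_change) \<le> - t * lambda_C"
    \<comment> \<open>Comparing logarithms is legitimate because \<open>p_change < 1\<close> makes
      \<open>1 - p_change\<close> positive.\<close>
    using assms ln_le_cancel_iff[of "1 - p_change" "exp (- t * lambda_C)"] by simp
  also have "\<dots> \<longleftrightarrow> lambda_C \<le> 1 / t * ln (1 / (1 - p_change))"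
    \<comment> \<open>Dividing by \<open>- t < 0\<close> reverses the inequality; the sign is
      absorbed by inverting the argument of \<open>ln\<close>.\<close>
    using \<open>t > 0\<close> assms by (auto simp: ln_div field_simps)
  finally show ?thesis
    by (simp only: t_def)
qed

end
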